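(* Let $\widehat{G}$ be a second countable locally compact abelian group with Haar measure $\nu_{\widehat{G}}$, let $\Gamma^\perp$ be a discrete subgroup of $\widehat{G}$, and let $\widehat{\alpha}\in\mathrm{Aut}(\widehat{G})$. Let $d_{\widehat{G}}:\widehat{G}\times\widehat{G}\to\mathbb{R}^+$ be an invariant metric, and let $B(\xi_0,r)=\{\xi\in\widehat{G}:d_{\widehat{G}}(\xi,\xi_0)<r\}$ for $\xi_0\in\widehat{G}$, $r>0$. Let $\Omega\subset\widehat{G}$ be any $\nu_{\widehat{G}}$-measurable section of $\widehat{G}/\Gamma^\perp$ and, for $r>0$, let $$\Omega^r_{\widehat{\alpha}}=\Omega\cap\bigcup_{\lambda\in\Gamma^\perp}\big(\widehat{\alpha}B(\mathrm{e},r)+\lambda\big).$$ Then $$\sharp\big(\Gamma^\perp\cap\widehat{\alpha}B(\mathrm{e},2r)\big)\ge\frac{1}{\nu_{\widehat{G}}(\Omega^r_{\widehat{\alpha}})}\,\nu_{\widehat{G}}\big(\widehat{\alpha}B(\mathrm{e},r)\big)\qquad\forall\ r>0.$$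
   Context: $\widehat{G}$ is written additively with identity $\mathrm{e}$. As throughout the source, the translation-invariant metric $d_{\widehat{G}}$ induces the topology of $\widehat{G}$ and its closed balls are compact. $\mathrm{Aut}(\widehat{G})$ denotes topological group automorphisms. A measurable section (fundamental set) $\Omega$ of $\widehat{G}/\Gamma^\perp$ is a measurable set containing exactly one representative of each coset of $\Gamma^\perp$. $\sharp$ denotes cardinality. *)

theory Defs
  imports "HOL-Analysis.Analysis"
begin

definition add_subgroup :: "'a::ab_group_add set \<Rightarrow> bool" where
  "add_subgroup H \<longleftrightarrow>
     0 \<in> H \<and> (\<forall>x\<in>H. \<forall>y\<in>H. x + y \<in> H) \<and> (\<forall>x\<in>H. - x \<in> H)"

definition topological_group_aut :: "('a::topological_ab_group_add \<Rightarrow> 'a) \<Rightarrow> bool" where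
  "topological_group_aut \<alpha> \<longleftrightarrow>
     Modules.additive \<alpha> \<and> homeomorphic_map euclidean euclidean \<alpha>"

text \<open>A Haar measure is a nonzero translation-invariant Radon measure on the Borel sets.\<close>

definition haar_measure :: "'a::{topological_ab_group_add, t2_space} measure \<Rightarrow> bool" where
  "haar_measure \<nu> \<longleftrightarrow>
     sets \<nu> = sets borel \<and>
     emeasure \<nu> UNIV \<noteq> 0 \<and>
     (\<forall>x. \<forall>A\<in>sets borel. emeasure \<nu> ((\<lambda>y. y + x) ` A) = emeasure \<nu> A) \<and>
     (\<forall>K. compact K \<longrightarrow> emeasure \<nu> K < \<infinity>) \<and>
     (\<forall>A\<in>sets borel. emeasure \<nu> A = (INF U\<in>{U. open U \<and> A \<subseteq> U}. emeasure \<nu> U)) \<and>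
     (\<forall>U. open U \<longrightarrow> emeasure \<nu> U = (SUP K\<in>{K. compact K \<and> K \<subseteq> U}. emeasure \<nu> K))"

text \<open>Measurability of a section is with respect to the completion of the measure, so that it
  need not be a Borel set.\<close>

definition measurable_section :: "'a::ab_group_add measure \<Rightarrow> 'a set \<Rightarrow> 'a set \<Rightarrow> bool" where
  "measurable_section \<nu> H \<Omega> \<longleftrightarrow>
     \<Omega> \<in> sets (completion \<nu>) \<and> (\<forall>\<xi>. \<exists>!\<omega>. \<omega> \<in> \<Omega> \<and> \<omega> \<in> (\<lambda>h. \<xi> + h) ` H)"

text \<open>The set \<open>\<Omega>\<^sup>r\<^sub>\<alpha>\<close>; \<open>d\<close> is the metric and \<open>H\<close> the discrete subgroup.\<close>

definition section_part ::
  "('a::ab_group_add \<Rightarrow> 'a \<Rightarrow> real) \<Rightarrow> 'a set \<Rightarrow> ('a \<Rightarrow> 'a) \<Rightarrow> 'a set \<Rightarrow> real \<Rightarrow> 'a set" where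
  "section_part d H \<alpha> \<Omega> r =
     \<Omega> \<inter> (\<Union>h\<in>H. (\<lambda>\<xi>. \<xi> + h) ` (\<alpha> ` Metric_space.mball UNIV d 0 r))"

end

theory Submission
  imports Defs
begin

text \<open>Let \<open>B = \<alpha> B(e,r)\<close>. The translates of \<open>\<Omega>\<close> by \<open>\<Gamma>\<^sup>\<bottom>\<close> partition the group, so translation
  invariance gives that \<open>\<nu> B\<close> is the integral over \<open>\<Omega>\<close> of the number of \<open>h\<close> in \<open>\<Gamma>\<^sup>\<bottom>\<close> with
  \<open>x + h \<in> B\<close>. This number vanishes off \<open>\<Omega>\<^sup>r\<^sub>\<alpha>\<close>. If \<open>h\<^sub>0\<close> is one such element, all the differences
  \<open>h - h\<^sub>0\<close> lie in \<open>\<Gamma>\<^sup>\<bottom> \<inter> (B - B)\<close>, which is contained in \<open>\<Gamma>\<^sup>\<bottom> \<inter> \<alpha> B(e,2r)\<close>.\<close>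

lemma add_subgroup_diff: "add_subgroup H \<Longrightarrow> x \<in> H \<Longrightarrow> y \<in> H \<Longrightarrow> x - y \<in> H"
  unfolding add_subgroup_def by (metis diff_conv_add_uminus)

text \<open>Needed because \<Omega> is measurable only for the completed measure, so translation
  invariance has to be available there. Preimages of null sets are null since \<open>f\<close>
  preserves the measure.\<close>

lemma distr_completion_self:
  assumes "f \<in> M \<rightarrow>\<^sub>M M" "distr M M f = M"
  shows "f \<in> completion M \<rightarrow>\<^sub>M completion M" "distr (completion M) (completion M) f = completion M"
proof -
  have "distr (completion M) M f = M"
    using assms by (simp add: distr_completion)
  then show "f \<in> completion M \<rightarrow>\<^sub>M completion M"
      "distr (completion M) (completion M) f = completion M"
    using completion.measurable_completion2[OF measurable_completion[OF assms(1)]]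
      completion.completion_distr_eq[OF measurable_completion[OF assms(1)]]
    by simp_all
qed

lemma haar_measure_distr_translation:
  assumes "haar_measure (\<nu> :: 'a::{topological_ab_group_add, t2_space} measure)"
  shows "(\<lambda>y. y + x) \<in> \<nu> \<rightarrow>\<^sub>M \<nu>" "distr \<nu> \<nu> (\<lambda>y. y + x) = \<nu>"
proof -
  have sets: "sets \<nu> = sets borel"
    and inv: "\<And>z A. A \<in> sets borel \<Longrightarrow> emeasure \<nu> ((\<lambda>y. y + z) ` A) = emeasure \<nu> A"
    using assms unfolding haar_measure_def by auto
  have "(\<lambda>y. y + x) \<in> borel_measurable borel"
    by (intro borel_measurable_continuous_onI continuous_intros)
  then show meas: "(\<lambda>y. y + x) \<in> \<nu> \<rightarrow>\<^sub>M \<nu>"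
    by (simp cong: measurable_cong_sets add: sets)
  show "distr \<nu> \<nu> (\<lambda>y. y + x) = \<nu>"
  proof (rule measure_eqI)
    fix A assume "A \<in> sets (distr \<nu> \<nu> (\<lambda>y. y + x))"
    then have A: "A \<in> sets \<nu>" by simp
    have "(\<lambda>y. y + x) -` A = (\<lambda>y. y + - x) ` A"
      by (auto simp: image_iff) (metis add_diff_cancel_right')
    then show "emeasure (distr \<nu> \<nu> (\<lambda>y. y + x)) A = emeasure \<nu> A"
      using A inv[of A "- x"] sets
      by (simp add: emeasure_distr[OF meas] sets_eq_imp_space_eq[OF sets])
  qed simp
qed

text \<open>Infinitely many points of \<open>H\<close> in \<open>K\<close> would accumulate
  somewhere, and differences of nearby points would be nonzero elements of \<open>H\<close>
  arbitrarily close to 0, although 0 is isolated in \<open>H\<close>.\<close>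

lemma finite_discrete_subgroup_Int_compact:
  fixes H :: "'a::{topological_ab_group_add, t2_space} set"
  assumes H: "add_subgroup H" "discrete H" and K: "compact K"
  shows "finite (H \<inter> K)"
proof (rule ccontr)
  assume "infinite (H \<inter> K)"
  then obtain p where p: "p islimpt (H \<inter> K)"
    using Heine_Borel_imp_Bolzano_Weierstrass[OF K] by blast
  have "0 isolated_in H"
    using H unfolding add_subgroup_def discrete_def by blast
  then obtain V where V: "open V" "V \<inter> H = {0}"
    unfolding isolated_in_def by blast
  have "((\<lambda>z. fst z - snd z) \<longlongrightarrow> p - p) (nhds p \<times>\<^sub>F nhds p)"
    by (intro tendsto_diff filterlim_fst filterlim_snd)
  then have "\<forall>\<^sub>F z in nhds p \<times>\<^sub>F nhds p. fst z - snd z \<in> V"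
    by (rule topological_tendstoD) (use V in auto)
  then obtain P Q where PQ: "eventually P (nhds p)" "eventually Q (nhds p)"
      "\<And>x y. P x \<Longrightarrow> Q y \<Longrightarrow> x - y \<in> V"
    unfolding eventually_prod_filter by auto
  have "eventually (\<lambda>x. P x \<and> Q x) (nhds p)"
    using PQ by (simp add: eventually_conj)
  then obtain W where W: "open W" "p \<in> W" "\<And>x. x \<in> W \<Longrightarrow> P x \<and> Q x"
    unfolding eventually_nhds by blast
  obtain x where x: "x \<in> H \<inter> K" "x \<in> W" "x \<noteq> p"
    using p W by (blast elim: islimptE)
  \<comment> \<open>Deleting \<open>x\<close> keeps an open neighbourhood of \<open>p\<close>, so a
    second point found there differs from \<open>x\<close>.\<close>
  have "open (W - {x})" "p \<in> W - {x}"
    using W x by auto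
  then obtain y where y: "y \<in> H \<inter> K" "y \<in> W - {x}"
    using islimptE[OF p \<open>p \<in> W - {x}\<close> \<open>open (W - {x})\<close>] by metis
  have "x - y \<in> V"
    using W x y by (intro PQ) auto
  moreover have "x - y \<in> H"
    using x y by (intro add_subgroup_diff[OF H(1)]) auto
  ultimately have "x - y \<in> V \<inter> H" ..
  then show False
    using V y by auto
qed

text \<open>\<open>M\<close> is kept abstract so that the completed Haar measure can be inserted.
  \<open>F\<close> is any finite set catching the elements of \<open>H\<close> that are differences
  of two points of \<open>B\<close>; it bounds how often \<open>B\<close> can cover a point modulo
  \<open>H\<close>.\<close>

lemma emeasure_section_le:
  fixes M :: "'a::ab_group_add measure"
  assumes space: "space M = UNIV" and H: "add_subgroup H" "countable H"
    and transl: "\<And>h. h \<in> H \<Longrightarrow> (\<lambda>y. y + h) \<in> M \<rightarrow>\<^sub>M M" "\<And>h. h \<in> H \<Longrightarrow> distr M M (\<lambda>y. y + h) = M"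
    and B: "B \<in> sets M" and \<Omega>: "\<Omega> \<in> sets M"
    and sect: "\<And>\<xi>. \<exists>!\<omega>. \<omega> \<in> \<Omega> \<and> \<omega> \<in> (\<lambda>h. \<xi> + h) ` H"
    and F: "finite F" "\<And>x h. x \<in> B \<Longrightarrow> h \<in> H \<Longrightarrow> x + h \<in> B \<Longrightarrow> h \<in> F"
  shows "emeasure M B \<le> of_nat (card F) * emeasure M (\<Omega> \<inter> (\<Union>h\<in>H. (\<lambda>x. x + h) ` B))"
proof -
  \<comment> \<open>\<open>X h\<close> is the piece of \<open>B\<close> in the tile \<Omega> + h,
    and \<open>Y h\<close> is that piece moved back into \<Omega>.\<close>
  define X where "X h = {y \<in> B. y - h \<in> \<Omega>}" for h
  define Y where "Y h = {x \<in> \<Omega>. x + h \<in> B}" for h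
  define S where "S = \<Omega> \<inter> (\<Union>h\<in>H. (\<lambda>x. x + h) ` B)"
  have minus: "- h \<in> H" if "h \<in> H" for h
    using H that by (auto simp: add_subgroup_def)
  have shift: "{y. y + h \<in> A} \<in> sets M" if "h \<in> H" "A \<in> sets M" for h A
    using measurable_sets[OF transl(1)[OF that(1)] that(2)] space by (simp add: vimage_def)
  have X: "X h \<in> sets M" if "h \<in> H" for h
  proof -
    have "X h = B \<inter> {y. y + - h \<in> \<Omega>}" by (auto simp: X_def)
    then show ?thesis using shift[OF minus[OF that] \<Omega>] B by simp
  qed
  have Y: "Y h \<in> sets M" if "h \<in> H" for h
  proof -
    have "Y h = \<Omega> \<inter> {y. y + h \<in> B}" by (auto simp: Y_def)
    then show ?thesis using shift[OF that B] \<Omega> by simp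
  qed
  have XY: "emeasure M (X h) = emeasure M (Y h)" if "h \<in> H" for h
  proof -
    have "emeasure M (X h) = emeasure (distr M M (\<lambda>y. y + h)) (X h)"
      using transl(2)[OF that] by simp
    also have "\<dots> = emeasure M ((\<lambda>y. y + h) -` X h)"
      by (simp add: emeasure_distr[OF transl(1)[OF that] X[OF that]] space)
    also have "(\<lambda>y. y + h) -` X h = Y h"
      by (auto simp: X_def Y_def)
    finally show ?thesis .
  qed
  \<comment> \<open>The sign of the index flips: \<open>S\<close> moves \<open>B\<close> by
    \<open>h\<close> into \<Omega>, whereas \<open>Y h\<close> consists of points of \<Omega> that
    \<open>h\<close> moves into \<open>B\<close>.\<close>
  have S_eq: "S = (\<Union>h\<in>H. Y h)"
  proof (intro equalityI subsetI)
    fix x assume "x \<in> S"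
    then obtain h b where "h \<in> H" "b \<in> B" "x \<in> \<Omega>" "x = b + h"
      unfolding S_def by blast
    then have "- h \<in> H" "x \<in> Y (- h)"
      using minus by (auto simp: Y_def)
    then show "x \<in> (\<Union>h\<in>H. Y h)" by blast
  next
    fix x assume "x \<in> (\<Union>h\<in>H. Y h)"
    then obtain h where h: "h \<in> H" "x \<in> \<Omega>" "x + h \<in> B"
      unfolding Y_def by blast
    then have "x \<in> (\<lambda>y. y + - h) ` B"
      by (auto simp: image_iff intro!: bexI[of _ "x + h"])
    then show "x \<in> S"
      using h minus unfolding S_def by blast
  qed
  have S: "S \<in> sets M"
    unfolding S_eq using Y H by (intro sets.countable_UN') auto
  have B_eq: "B = (\<Union>h\<in>H. X h)"
  proof (intro equalityI subsetI)
    fix x assume x: "x \<in> B"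
    obtain h where h: "h \<in> H" "x + h \<in> \<Omega>"
      using sect[of x] by blast
    then have "x \<in> X (- h)"
      using x by (simp add: X_def)
    then show "x \<in> (\<Union>h\<in>H. X h)" using h minus by blast
  qed (auto simp: X_def)
  \<comment> \<open>A common point x of two pieces would give its coset two representatives, x - h
    and x - k.\<close>
  have disj: "disjoint_family_on X H"
    unfolding disjoint_family_on_def
  proof (intro ballI impI, rule ccontr)
    fix h k assume hk: "h \<in> H" "k \<in> H" "h \<noteq> k" "X h \<inter> X k \<noteq> {}"
    then obtain x where x: "x - h \<in> \<Omega>" "x - k \<in> \<Omega>"
      unfolding X_def by blast
    have "x - h \<in> (\<lambda>h. x + h) ` H" "x - k \<in> (\<lambda>h. x + h) ` H"
      using minus hk by (auto simp: image_iff intro: bexI[of _ "- h"] bexI[of _ "- k"])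
    then have "x - h = x - k"
      using sect[of x] x by blast
    then show False using hk by simp
  qed
  \<comment> \<open>The left side counts the \<open>h\<close> in \<open>H\<close> with x + h in
    \<open>B\<close>.\<close>
  have mult: "(\<integral>\<^sup>+h. indicator (Y h) x \<partial>count_space H) \<le> of_nat (card F) * indicator S x" for x
  proof (cases "x \<in> S")
    case False
    then have "indicator (Y h) x = (0::ennreal)" if "h \<in> H" for h
      using that by (auto simp: S_eq indicator_def)
    then have "(\<integral>\<^sup>+h. indicator (Y h) x \<partial>count_space H) = (\<integral>\<^sup>+h. 0 \<partial>count_space H)"
      by (intro nn_integral_cong) simp
    then show ?thesis by simp
  next
    case True
    define N where "N = {h \<in> H. x \<in> Y h}"
    obtain k where k: "k \<in> H" "x + k \<in> B"
      using True by (auto simp: S_eq Y_def)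
    \<comment> \<open>Take x + k as base point in \<open>B\<close>: adding h - k to it gives x + h,
      again in \<open>B\<close>.\<close>
    have sub: "(\<lambda>h. h - k) ` N \<subseteq> F"
    proof clarsimp
      fix h assume "h \<in> N"
      then have "h \<in> H" "x + h \<in> B" by (auto simp: N_def Y_def)
      then show "h - k \<in> F"
        using F(2)[OF k(2), of "h - k"] add_subgroup_diff[OF H(1)] k(1) by simp
    qed
    have inj: "inj_on (\<lambda>h. h - k) N" by (simp add: inj_on_def)
    have fin: "finite N"
      using finite_imageD[OF finite_subset[OF sub F(1)] inj] .
    have "(\<integral>\<^sup>+h. indicator (Y h) x \<partial>count_space H) = (\<integral>\<^sup>+h. indicator N h \<partial>count_space H)"
      by (intro nn_integral_cong) (auto simp: N_def indicator_def)
    also have "\<dots> = emeasure (count_space H) N"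
      by (intro nn_integral_indicator) (auto simp: N_def)
    also have "\<dots> = of_nat (card N)"
      using fin by (intro emeasure_count_space_finite) (auto simp: N_def)
    also have "\<dots> \<le> of_nat (card F)"
      using card_inj_on_le[OF inj sub F(1)] by simp
    finally show ?thesis using True by simp
  qed
  have "emeasure M B = (\<integral>\<^sup>+h. emeasure M (X h) \<partial>count_space H)"
    using emeasure_UN_countable[of H X M] X H disj B_eq by simp
  also have "\<dots> = (\<integral>\<^sup>+h. \<integral>\<^sup>+x. indicator (Y h) x \<partial>M \<partial>count_space H)"
    using XY Y by (intro nn_integral_cong) simp
  \<comment> \<open>Exchanging sum and integral is legitimate because \<open>H\<close> is
    countable.\<close>
  also have "\<dots> = (\<integral>\<^sup>+x. \<integral>\<^sup>+h. indicator (Y h) x \<partial>count_space H \<partial>M)"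
    using Y H by (intro nn_integral_count_space_nn_integral[symmetric]) auto
  also have "\<dots> \<le> (\<integral>\<^sup>+x. of_nat (card F) * indicator S x \<partial>M)"
    by (intro nn_integral_mono mult)
  also have "\<dots> = of_nat (card F) * emeasure M S"
    using S by (simp add: nn_integral_cmult_indicator)
  finally show ?thesis unfolding S_def .
qed

theorem lemma31:
  fixes \<nu> :: "'a::{topological_ab_group_add, t2_space, second_countable_topology} measure"
    and \<Gamma>_perp \<Omega> :: "'a set"
    and \<alpha> :: "'a \<Rightarrow> 'a"
    and d :: "'a \<Rightarrow> 'a \<Rightarrow> real"
  assumes "locally_compact_space (euclidean :: 'a topology)"
    and "haar_measure \<nu>"
    and "add_subgroup \<Gamma>_perp" and "discrete \<Gamma>_perp"
    and "topological_group_aut \<alpha>"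
    and "Metric_space UNIV d"
    and "\<And>x y z. d (x + z) (y + z) = d x y"
    and "Metric_space.mtopology UNIV d = euclidean"
    and "\<And>x r. compact (Metric_space.mcball UNIV d x r)"
    and "measurable_section \<nu> \<Gamma>_perp \<Omega>"
  shows "\<forall>r>0. of_nat (card (\<Gamma>_perp \<inter> \<alpha> ` Metric_space.mball UNIV d 0 (2 * r)))
           \<ge> 1 / emeasure (completion \<nu>) (section_part d \<Gamma>_perp \<alpha> \<Omega> r)
             * emeasure (completion \<nu>) (\<alpha> ` Metric_space.mball UNIV d 0 r)"
proof (intro allI impI)
  fix r :: real assume "r > 0"
  interpret Metric_space UNIV d by fact
  interpret \<alpha>: Modules.additive \<alpha>
    using assms(5) unfolding topological_group_aut_def by blast
  have homeo: "homeomorphic_map euclidean euclidean \<alpha>"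
    using assms(5) unfolding topological_group_aut_def by blast
  define B where "B = \<alpha> ` mball 0 r"
  define F where "F = \<Gamma>_perp \<inter> \<alpha> ` mball 0 (2 * r)"
  have "open B"
    using openin_mball[of 0 r] homeomorphic_imp_open_map[OF homeo] assms(8)
    unfolding B_def open_map_def by simp
  moreover have "sets \<nu> = sets borel"
    using assms(2) by (simp add: haar_measure_def)
  ultimately have B: "B \<in> sets (completion \<nu>)"
    by simp
  \<comment> \<open>Passing to the closed ball gives a compact image and hence finiteness of
    \<open>F\<close>; for an infinite set \<open>card\<close> would be 0.\<close>
  have "continuous_on UNIV \<alpha>"
    using homeomorphic_imp_continuous_map[OF homeo] by simp
  then have "compact (\<alpha> ` mcball 0 (2 * r))"
    using assms(9) by (intro compact_continuous_image) (auto intro: continuous_on_subset)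
  then have "finite (\<Gamma>_perp \<inter> \<alpha> ` mcball 0 (2 * r))"
    using finite_discrete_subgroup_Int_compact assms(3,4) by blast
  then have F: "finite F"
    unfolding F_def by (rule rev_finite_subset) auto
  have diffs: "h \<in> F" if xh: "x \<in> B" "h \<in> \<Gamma>_perp" "x + h \<in> B" for x h
  proof -
    obtain u v where uv: "x = \<alpha> u" "x + h = \<alpha> v" "d 0 u < r" "d 0 v < r"
      using xh unfolding B_def by auto
    \<comment> \<open>Translation by \<open>u\<close> turns a distance from 0 into a distance
      between two points of the ball; this is where the radius doubles.\<close>
    have "d 0 (v - u) = d u v"
      using assms(7)[of 0 u "v - u"] by simp
    also have "\<dots> < 2 * r"
      using triangle[of u 0 v] uv commute[of u 0] by simp
    finally have "v - u \<in> mball 0 (2 * r)" by simp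
    moreover have "h = \<alpha> (v - u)"
      using uv \<alpha>.diff[of v u] by (metis add_diff_cancel_left')
    ultimately show ?thesis using xh(2) unfolding F_def by blast
  qed
  \<comment> \<open>Closed balls of integer radius are compact and exhaust the group, and each meets
    the discrete subgroup in a finite set.\<close>
  have "\<Gamma>_perp \<subseteq> (\<Union>n. \<Gamma>_perp \<inter> mcball 0 (real n))"
    using real_arch_simple by auto
  moreover have "countable (\<Union>n. \<Gamma>_perp \<inter> mcball 0 (real n))"
    using finite_discrete_subgroup_Int_compact[OF assms(3,4,9)]
    by (intro countable_UN) (auto intro: countable_finite)
  ultimately have "countable \<Gamma>_perp"
    by (rule countable_subset)
  moreover have "space (completion \<nu>) = UNIV"
    using sets_eq_imp_space_eq[OF \<open>sets \<nu> = sets borel\<close>] by simp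
  ultimately have "emeasure (completion \<nu>) B
      \<le> of_nat (card F) * emeasure (completion \<nu>) (section_part d \<Gamma>_perp \<alpha> \<Omega> r)"
    unfolding section_part_def B_def[symmetric]
    using assms(10) unfolding measurable_section_def
    by (intro emeasure_section_le B F diffs assms(3)
        distr_completion_self haar_measure_distr_translation[OF assms(2)]) auto
  \<comment> \<open>If the denominator is 0, the previous bound forces the numerator to be 0 as
    well, and 0 / 0 = 0 in \<open>ennreal\<close>.\<close>
  then have "emeasure (completion \<nu>) B / emeasure (completion \<nu>) (section_part d \<Gamma>_perp \<alpha> \<Omega> r)
      \<le> of_nat (card F)"
    (is "?b / ?s \<le> _")
    by (cases "?s = 0") (simp_all add: divide_le_posI_ennreal zero_less_iff_neq_zero mult.commute
        del: emeasure_completion)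
  then show "of_nat (card (\<Gamma>_perp \<inter> \<alpha> ` mball 0 (2 * r)))
      \<ge> 1 / emeasure (completion \<nu>) (section_part d \<Gamma>_perp \<alpha> \<Omega> r)
        * emeasure (completion \<nu>) (\<alpha> ` mball 0 r)"
    unfolding F_def B_def by (simp add: ennreal_divide_times)
qed

end
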